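(* Let $\mathbb{X}$ be an additive linear category with monoidal coalgebra modality $(!,\delta,\varepsilon,m_\otimes,m_K,\Delta,e)$, and let $\nabla:=(\delta\otimes\delta)m_\otimes!(\varepsilon\otimes e+e\otimes\varepsilon)$ and $u:=m_K!(0)$ be the multiplication and unit of the induced additive bialgebra modality. Then every codereliction $\eta:A\to{!A}$ for this additive bialgebra modality satisfies the monoidal rule $$(1\otimes\eta)\,m_\otimes=(\varepsilon\otimes1)\,\eta:\ {!A}\otimes B\to{!(A\otimes B)}.$$
   Context: Composition is in diagrammatic order ($fg$ means first $f$, then $g$). Symmetric monoidal categories are treated as strict (associators and unitors suppressed), with tensor $\otimes$, unit $K$, symmetry $\sigma:A\otimes B\to B\otimes A$. An additive symmetric monoidal category is a symmetric monoidal category enriched in commutative monoids (hom-sets have $+$ and $0$, no negatives, no biproducts assumed), with composition and $\otimes$ preserving $+$ and $0$ in each variable. A coalgebra modality $(!,\delta,\varepsilon,\Delta,e)$ is a comonad $(!,\delta,\varepsilon)$, $\delta:{!A}\to{!!A}$, $\varepsilon:{!A}\to A$, with natural transformations $\Delta:{!A}\to{!A}\otimes{!A}$, $e:{!A}\to K$ such that each $({!A},\Delta,e)$ is a cocommutative comonoid and $\delta\Delta=\Delta(\delta\otimes\delta)$. A monoidal coalgebra modality $(!,\delta,\varepsilon,m_\otimes,m_K,\Delta,e)$ is a coalgebra modality with a natural transformation $m_\otimes:{!A}\otimes{!B}\to{!(A\otimes B)}$ and a map $m_K:K\to{!K}$ such that: $(!,m_\otimes,m_K)$ is a (lax) symmetric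 monoidal endofunctor; $\delta,\varepsilon$ are monoidal: $m_\otimes\delta=(\delta\otimes\delta)m_\otimes!(m_\otimes)$, $m_K\delta=m_K!(m_K)$, $m_\otimes\varepsilon=\varepsilon\otimes\varepsilon$, $m_K\varepsilon=1$; $\Delta,e$ are monoidal: $m_\otimes\Delta=(\Delta\otimes\Delta)(1\otimes\sigma\otimes1)(m_\otimes\otimes m_\otimes)$, $m_\otimes e=e\otimes e$, $m_K\Delta=m_K\otimes m_K$, $m_Ke=1$; and $\Delta,e$ are $!$-coalgebra morphisms: $\delta\,!(\Delta)=\Delta(\delta\otimes\delta)m_\otimes$, $\delta\,!(e)=e\,m_K$. An additive linear category is an additive symmetric monoidal category equipped with a monoidal coalgebra modality. A codereliction is a natural transformation $\eta:A\to{!A}$ satisfying: constant rule $\eta e=0$; product rule $\eta\Delta=\eta\otimes u+u\otimes\eta$; linear rule $\eta\varepsilon=1$; and chain rule $(1\otimes\eta)\nabla\delta=(\Delta\otimes\eta)(1\otimes\nabla)(\delta\otimes\eta)\nabla$ as maps ${!A}\otimes A\to{!!A}$ (the second $\eta$ on the right-hand side is at ${!A}$). *)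

theory Defs
  imports Main
begin

text \<open>
  Composition is in diagrammatic order: \<open>f \<cdot> g\<close> is first \<open>f\<close>, then \<open>g\<close>.
  Outside the carriers \<open>Ob\<close> and \<open>Ar\<close>, and on non-composable or non-parallel arguments,
  all operations are unconstrained.
\<close>

record ('o, 'a) category =
  Ob :: "'o set"
  Ar :: "'a set"
  Dom :: "'a \<Rightarrow> 'o"
  Cod :: "'a \<Rightarrow> 'o"
  Idn :: "'o \<Rightarrow> 'a"  (\<open>\<one>\<index>\<close>)
  Cmp :: "'a \<Rightarrow> 'a \<Rightarrow> 'a"  (infixl \<open>\<cdot>\<index>\<close> 65)

definition Hom :: "('o, 'a, 'm) category_scheme \<Rightarrow> 'o \<Rightarrow> 'o \<Rightarrow> 'a set"
  where "Hom X A B = {f \<in> Ar X. Dom X f = A \<and> Cod X f = B}"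

locale category =
  fixes X :: "('o, 'a, 'm) category_scheme" (structure)
  assumes Dom_Ob: "f \<in> Ar X \<Longrightarrow> Dom X f \<in> Ob X"
    and Cod_Ob: "f \<in> Ar X \<Longrightarrow> Cod X f \<in> Ob X"
    and Idn_Hom: "A \<in> Ob X \<Longrightarrow> \<one> A \<in> Hom X A A"
    and Cmp_Hom: "\<lbrakk>f \<in> Hom X A B; g \<in> Hom X B C\<rbrakk> \<Longrightarrow> f \<cdot> g \<in> Hom X A C"
    and Idn_left: "f \<in> Hom X A B \<Longrightarrow> \<one> A \<cdot> f = f"
    and Idn_right: "f \<in> Hom X A B \<Longrightarrow> f \<cdot> \<one> B = f"
    and Cmp_assoc: "\<lbrakk>f \<in> Hom X A B; g \<in> Hom X B C; h \<in> Hom X C D\<rbrakk>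
          \<Longrightarrow> (f \<cdot> g) \<cdot> h = f \<cdot> (g \<cdot> h)"

text \<open>
  Symmetric monoidal categories are strict: associators and unitors are identities, so the
  coherence isomorphisms do not appear. The symmetry is not assumed to be an identity.
  The unit law \<open>\<sigma> A K = \<one> A\<close> follows from the hexagon and invertibility.
\<close>

record ('o, 'a) smc = "('o, 'a) category" +
  TenO :: "'o \<Rightarrow> 'o \<Rightarrow> 'o"  (infixr \<open>\<odot>\<index>\<close> 75)
  Ten :: "'a \<Rightarrow> 'a \<Rightarrow> 'a"  (infixr \<open>\<otimes>\<index>\<close> 75)
  Unit :: "'o"  (\<open>\<K>\<index>\<close>)
  Sym :: "'o \<Rightarrow> 'o \<Rightarrow> 'a"  (\<open>\<sigma>\<index>\<close>)

locale symmetric_monoidal_category = category X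
  for X :: "('o, 'a, 'm) smc_scheme" (structure) +
  assumes TenO_Ob: "\<lbrakk>A \<in> Ob X; B \<in> Ob X\<rbrakk> \<Longrightarrow> A \<odot> B \<in> Ob X"
    and Unit_Ob: "\<K> \<in> Ob X"
    and Ten_Hom: "\<lbrakk>f \<in> Hom X A B; g \<in> Hom X C D\<rbrakk> \<Longrightarrow> f \<otimes> g \<in> Hom X (A \<odot> C) (B \<odot> D)"
    and Ten_Idn: "\<lbrakk>A \<in> Ob X; B \<in> Ob X\<rbrakk> \<Longrightarrow> \<one> A \<otimes> \<one> B = \<one> (A \<odot> B)"
    and Ten_Cmp: "\<lbrakk>f \<in> Hom X A B; f' \<in> Hom X B C; g \<in> Hom X A' B'; g' \<in> Hom X B' C'\<rbrakk>
          \<Longrightarrow> (f \<cdot> f') \<otimes> (g \<cdot> g') = (f \<otimes> g) \<cdot> (f' \<otimes> g')"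
    and TenO_assoc: "\<lbrakk>A \<in> Ob X; B \<in> Ob X; C \<in> Ob X\<rbrakk> \<Longrightarrow> (A \<odot> B) \<odot> C = A \<odot> (B \<odot> C)"
    and Ten_assoc: "\<lbrakk>f \<in> Ar X; g \<in> Ar X; h \<in> Ar X\<rbrakk> \<Longrightarrow> (f \<otimes> g) \<otimes> h = f \<otimes> (g \<otimes> h)"
    and TenO_Unit_left: "A \<in> Ob X \<Longrightarrow> \<K> \<odot> A = A"
    and TenO_Unit_right: "A \<in> Ob X \<Longrightarrow> A \<odot> \<K> = A"
    and Ten_Unit_left: "f \<in> Ar X \<Longrightarrow> \<one> \<K> \<otimes> f = f"
    and Ten_Unit_right: "f \<in> Ar X \<Longrightarrow> f \<otimes> \<one> \<K> = f"
    and Sym_Hom: "\<lbrakk>A \<in> Ob X; B \<in> Ob X\<rbrakk> \<Longrightarrow> \<sigma> A B \<in> Hom X (A \<odot> B) (B \<odot> A)"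
    and Sym_nat: "\<lbrakk>f \<in> Hom X A A'; g \<in> Hom X B B'\<rbrakk>
          \<Longrightarrow> (f \<otimes> g) \<cdot> \<sigma> A' B' = \<sigma> A B \<cdot> (g \<otimes> f)"
    and Sym_Sym: "\<lbrakk>A \<in> Ob X; B \<in> Ob X\<rbrakk> \<Longrightarrow> \<sigma> A B \<cdot> \<sigma> B A = \<one> (A \<odot> B)"
    and Sym_hexagon: "\<lbrakk>A \<in> Ob X; B \<in> Ob X; C \<in> Ob X\<rbrakk>
          \<Longrightarrow> \<sigma> A (B \<odot> C) = (\<sigma> A B \<otimes> \<one> C) \<cdot> (\<one> B \<otimes> \<sigma> A C)"

record ('o, 'a) asmc = "('o, 'a) smc" +
  Plus :: "'a \<Rightarrow> 'a \<Rightarrow> 'a"  (infixl \<open>\<oplus>\<index>\<close> 60)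
  Zero :: "'o \<Rightarrow> 'o \<Rightarrow> 'a"  (\<open>\<zero>\<index>\<close>)

locale additive_symmetric_monoidal_category = symmetric_monoidal_category X
  for X :: "('o, 'a, 'm) asmc_scheme" (structure) +
  assumes Plus_Hom: "\<lbrakk>f \<in> Hom X A B; g \<in> Hom X A B\<rbrakk> \<Longrightarrow> f \<oplus> g \<in> Hom X A B"
    and Zero_Hom: "\<lbrakk>A \<in> Ob X; B \<in> Ob X\<rbrakk> \<Longrightarrow> \<zero> A B \<in> Hom X A B"
    and Plus_assoc: "\<lbrakk>f \<in> Hom X A B; g \<in> Hom X A B; h \<in> Hom X A B\<rbrakk>
          \<Longrightarrow> (f \<oplus> g) \<oplus> h = f \<oplus> (g \<oplus> h)"
    and Plus_comm: "\<lbrakk>f \<in> Hom X A B; g \<in> Hom X A B\<rbrakk> \<Longrightarrow> f \<oplus> g = g \<oplus> f"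
    and Plus_Zero: "f \<in> Hom X A B \<Longrightarrow> f \<oplus> \<zero> A B = f"
    and Cmp_Plus_left: "\<lbrakk>f \<in> Hom X A B; g \<in> Hom X A B; h \<in> Hom X B C\<rbrakk>
          \<Longrightarrow> (f \<oplus> g) \<cdot> h = (f \<cdot> h) \<oplus> (g \<cdot> h)"
    and Cmp_Plus_right: "\<lbrakk>f \<in> Hom X A B; g \<in> Hom X B C; h \<in> Hom X B C\<rbrakk>
          \<Longrightarrow> f \<cdot> (g \<oplus> h) = (f \<cdot> g) \<oplus> (f \<cdot> h)"
    and Cmp_Zero_left: "\<lbrakk>A \<in> Ob X; f \<in> Hom X B C\<rbrakk> \<Longrightarrow> \<zero> A B \<cdot> f = \<zero> A C"
    and Cmp_Zero_right: "\<lbrakk>f \<in> Hom X A B; C \<in> Ob X\<rbrakk> \<Longrightarrow> f \<cdot> \<zero> B C = \<zero> A C"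
    and Ten_Plus_left: "\<lbrakk>f \<in> Hom X A B; g \<in> Hom X A B; h \<in> Hom X C D\<rbrakk>
          \<Longrightarrow> (f \<oplus> g) \<otimes> h = (f \<otimes> h) \<oplus> (g \<otimes> h)"
    and Ten_Plus_right: "\<lbrakk>f \<in> Hom X A B; g \<in> Hom X C D; h \<in> Hom X C D\<rbrakk>
          \<Longrightarrow> f \<otimes> (g \<oplus> h) = (f \<otimes> g) \<oplus> (f \<otimes> h)"
    and Ten_Zero_left: "\<lbrakk>A \<in> Ob X; B \<in> Ob X; f \<in> Hom X C D\<rbrakk>
          \<Longrightarrow> \<zero> A B \<otimes> f = \<zero> (A \<odot> C) (B \<odot> D)"
    and Ten_Zero_right: "\<lbrakk>f \<in> Hom X A B; C \<in> Ob X; D \<in> Ob X\<rbrakk>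
          \<Longrightarrow> f \<otimes> \<zero> C D = \<zero> (A \<odot> C) (B \<odot> D)"

record ('o, 'a) coalg_mod = "('o, 'a) asmc" +
  BangO :: "'o \<Rightarrow> 'o"  (\<open>!\<^sub>o\<index>\<close>)
  Bang :: "'a \<Rightarrow> 'a"  (\<open>!\<^sub>a\<index>\<close>)
  Dig :: "'o \<Rightarrow> 'a"  (\<open>\<delta>\<index>\<close>)
  Der :: "'o \<Rightarrow> 'a"  (\<open>\<epsilon>\<index>\<close>)
  Comul :: "'o \<Rightarrow> 'a"  (\<open>\<Delta>\<index>\<close>)
  Couni :: "'o \<Rightarrow> 'a"  (\<open>\<e>\<index>\<close>)

text \<open>The additive structure carried by the record is not used in the next locale.\<close>

locale coalgebra_modality = symmetric_monoidal_category X
  for X :: "('o, 'a, 'm) coalg_mod_scheme" (structure) +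
  assumes BangO_Ob: "A \<in> Ob X \<Longrightarrow> !\<^sub>o A \<in> Ob X"
    and Bang_Hom: "f \<in> Hom X A B \<Longrightarrow> !\<^sub>a f \<in> Hom X (!\<^sub>o A) (!\<^sub>o B)"
    and Bang_Idn: "A \<in> Ob X \<Longrightarrow> !\<^sub>a (\<one> A) = \<one> (!\<^sub>o A)"
    and Bang_Cmp: "\<lbrakk>f \<in> Hom X A B; g \<in> Hom X B C\<rbrakk> \<Longrightarrow> !\<^sub>a (f \<cdot> g) = !\<^sub>a f \<cdot> !\<^sub>a g"
    and Dig_Hom: "A \<in> Ob X \<Longrightarrow> \<delta> A \<in> Hom X (!\<^sub>o A) (!\<^sub>o (!\<^sub>o A))"
    and Dig_nat: "f \<in> Hom X A B \<Longrightarrow> !\<^sub>a f \<cdot> \<delta> B = \<delta> A \<cdot> !\<^sub>a (!\<^sub>a f)"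
    and Der_Hom: "A \<in> Ob X \<Longrightarrow> \<epsilon> A \<in> Hom X (!\<^sub>o A) A"
    and Der_nat: "f \<in> Hom X A B \<Longrightarrow> !\<^sub>a f \<cdot> \<epsilon> B = \<epsilon> A \<cdot> f"
    and Dig_Dig: "A \<in> Ob X \<Longrightarrow> \<delta> A \<cdot> \<delta> (!\<^sub>o A) = \<delta> A \<cdot> !\<^sub>a (\<delta> A)"
    and Dig_Der: "A \<in> Ob X \<Longrightarrow> \<delta> A \<cdot> \<epsilon> (!\<^sub>o A) = \<one> (!\<^sub>o A)"
    and Dig_Bang_Der: "A \<in> Ob X \<Longrightarrow> \<delta> A \<cdot> !\<^sub>a (\<epsilon> A) = \<one> (!\<^sub>o A)"
    and Comul_Hom: "A \<in> Ob X \<Longrightarrow> \<Delta> A \<in> Hom X (!\<^sub>o A) (!\<^sub>o A \<odot> !\<^sub>o A)"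
    and Comul_nat: "f \<in> Hom X A B \<Longrightarrow> !\<^sub>a f \<cdot> \<Delta> B = \<Delta> A \<cdot> (!\<^sub>a f \<otimes> !\<^sub>a f)"
    and Couni_Hom: "A \<in> Ob X \<Longrightarrow> \<e> A \<in> Hom X (!\<^sub>o A) \<K>"
    and Couni_nat: "f \<in> Hom X A B \<Longrightarrow> !\<^sub>a f \<cdot> \<e> B = \<e> A"
    and Comul_coassoc: "A \<in> Ob X
          \<Longrightarrow> \<Delta> A \<cdot> (\<Delta> A \<otimes> \<one> (!\<^sub>o A)) = \<Delta> A \<cdot> (\<one> (!\<^sub>o A) \<otimes> \<Delta> A)"
    and Comul_Couni_left: "A \<in> Ob X \<Longrightarrow> \<Delta> A \<cdot> (\<e> A \<otimes> \<one> (!\<^sub>o A)) = \<one> (!\<^sub>o A)"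
    and Comul_Couni_right: "A \<in> Ob X \<Longrightarrow> \<Delta> A \<cdot> (\<one> (!\<^sub>o A) \<otimes> \<e> A) = \<one> (!\<^sub>o A)"
    and Comul_cocomm: "A \<in> Ob X \<Longrightarrow> \<Delta> A \<cdot> \<sigma> (!\<^sub>o A) (!\<^sub>o A) = \<Delta> A"
    and Dig_Comul: "A \<in> Ob X \<Longrightarrow> \<delta> A \<cdot> \<Delta> (!\<^sub>o A) = \<Delta> A \<cdot> (\<delta> A \<otimes> \<delta> A)"

record ('o, 'a) mon_coalg_mod = "('o, 'a) coalg_mod" +
  Mon :: "'o \<Rightarrow> 'o \<Rightarrow> 'a"  (\<open>\<m>\<^sub>\<otimes>\<index>\<close>)
  MonU :: "'a"  (\<open>\<m>\<^sub>K\<index>\<close>)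

locale monoidal_coalgebra_modality = coalgebra_modality X
  for X :: "('o, 'a, 'm) mon_coalg_mod_scheme" (structure) +
  assumes Mon_Hom: "\<lbrakk>A \<in> Ob X; B \<in> Ob X\<rbrakk>
          \<Longrightarrow> \<m>\<^sub>\<otimes> A B \<in> Hom X (!\<^sub>o A \<odot> !\<^sub>o B) (!\<^sub>o (A \<odot> B))"
    and Mon_nat: "\<lbrakk>f \<in> Hom X A A'; g \<in> Hom X B B'\<rbrakk>
          \<Longrightarrow> (!\<^sub>a f \<otimes> !\<^sub>a g) \<cdot> \<m>\<^sub>\<otimes> A' B' = \<m>\<^sub>\<otimes> A B \<cdot> !\<^sub>a (f \<otimes> g)"
    and MonU_Hom: "\<m>\<^sub>K \<in> Hom X \<K> (!\<^sub>o \<K>)"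
    and Mon_assoc: "\<lbrakk>A \<in> Ob X; B \<in> Ob X; C \<in> Ob X\<rbrakk>
          \<Longrightarrow> (\<m>\<^sub>\<otimes> A B \<otimes> \<one> (!\<^sub>o C)) \<cdot> \<m>\<^sub>\<otimes> (A \<odot> B) C
            = (\<one> (!\<^sub>o A) \<otimes> \<m>\<^sub>\<otimes> B C) \<cdot> \<m>\<^sub>\<otimes> A (B \<odot> C)"
    and Mon_unit_left: "A \<in> Ob X \<Longrightarrow> (\<m>\<^sub>K \<otimes> \<one> (!\<^sub>o A)) \<cdot> \<m>\<^sub>\<otimes> \<K> A = \<one> (!\<^sub>o A)"
    and Mon_unit_right: "A \<in> Ob X \<Longrightarrow> (\<one> (!\<^sub>o A) \<otimes> \<m>\<^sub>K) \<cdot> \<m>\<^sub>\<otimes> A \<K> = \<one> (!\<^sub>o A)"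
    and Mon_Sym: "\<lbrakk>A \<in> Ob X; B \<in> Ob X\<rbrakk>
          \<Longrightarrow> \<sigma> (!\<^sub>o A) (!\<^sub>o B) \<cdot> \<m>\<^sub>\<otimes> B A = \<m>\<^sub>\<otimes> A B \<cdot> !\<^sub>a (\<sigma> A B)"
    and Mon_Dig: "\<lbrakk>A \<in> Ob X; B \<in> Ob X\<rbrakk>
          \<Longrightarrow> \<m>\<^sub>\<otimes> A B \<cdot> \<delta> (A \<odot> B)
            = (\<delta> A \<otimes> \<delta> B) \<cdot> \<m>\<^sub>\<otimes> (!\<^sub>o A) (!\<^sub>o B) \<cdot> !\<^sub>a (\<m>\<^sub>\<otimes> A B)"
    and MonU_Dig: "\<m>\<^sub>K \<cdot> \<delta> \<K> = \<m>\<^sub>K \<cdot> !\<^sub>a \<m>\<^sub>K"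
    and Mon_Der: "\<lbrakk>A \<in> Ob X; B \<in> Ob X\<rbrakk> \<Longrightarrow> \<m>\<^sub>\<otimes> A B \<cdot> \<epsilon> (A \<odot> B) = \<epsilon> A \<otimes> \<epsilon> B"
    and MonU_Der: "\<m>\<^sub>K \<cdot> \<epsilon> \<K> = \<one> \<K>"
    and Mon_Comul: "\<lbrakk>A \<in> Ob X; B \<in> Ob X\<rbrakk>
          \<Longrightarrow> \<m>\<^sub>\<otimes> A B \<cdot> \<Delta> (A \<odot> B)
            = (\<Delta> A \<otimes> \<Delta> B) \<cdot> (\<one> (!\<^sub>o A) \<otimes> \<sigma> (!\<^sub>o A) (!\<^sub>o B) \<otimes> \<one> (!\<^sub>o B))
                \<cdot> (\<m>\<^sub>\<otimes> A B \<otimes> \<m>\<^sub>\<otimes> A B)"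
    and Mon_Couni: "\<lbrakk>A \<in> Ob X; B \<in> Ob X\<rbrakk> \<Longrightarrow> \<m>\<^sub>\<otimes> A B \<cdot> \<e> (A \<odot> B) = \<e> A \<otimes> \<e> B"
    and MonU_Comul: "\<m>\<^sub>K \<cdot> \<Delta> \<K> = \<m>\<^sub>K \<otimes> \<m>\<^sub>K"
    and MonU_Couni: "\<m>\<^sub>K \<cdot> \<e> \<K> = \<one> \<K>"
    and Dig_Bang_Comul: "A \<in> Ob X
          \<Longrightarrow> \<delta> A \<cdot> !\<^sub>a (\<Delta> A) = \<Delta> A \<cdot> (\<delta> A \<otimes> \<delta> A) \<cdot> \<m>\<^sub>\<otimes> (!\<^sub>o A) (!\<^sub>o A)"
    and Dig_Bang_Couni: "A \<in> Ob X \<Longrightarrow> \<delta> A \<cdot> !\<^sub>a (\<e> A) = \<e> A \<cdot> \<m>\<^sub>K"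

locale additive_linear_category =
  additive_symmetric_monoidal_category X + monoidal_coalgebra_modality X
  for X :: "('o, 'a, 'm) mon_coalg_mod_scheme" (structure)

text \<open>
  The induced multiplication and unit. By strictness, \<open>\<epsilon> A \<otimes> \<e> A\<close> and \<open>\<e> A \<otimes> \<epsilon> A\<close> both have
  codomain \<open>A\<close>, so the sum is formed in \<open>Hom X (!\<^sub>o A \<odot> !\<^sub>o A) A\<close>.
\<close>

definition induced_mult :: "('o, 'a, 'm) mon_coalg_mod_scheme \<Rightarrow> 'o \<Rightarrow> 'a"  (\<open>\<nabla>\<index>\<close>)
  where "induced_mult X A =
    (\<delta>\<^bsub>X\<^esub> A \<otimes>\<^bsub>X\<^esub> \<delta>\<^bsub>X\<^esub> A) \<cdot>\<^bsub>X\<^esub> \<m>\<^sub>\<otimes>\<^bsub>X\<^esub> (!\<^sub>o\<^bsub>X\<^esub> A) (!\<^sub>o\<^bsub>X\<^esub> A)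
      \<cdot>\<^bsub>X\<^esub> !\<^sub>a\<^bsub>X\<^esub> (\<epsilon>\<^bsub>X\<^esub> A \<otimes>\<^bsub>X\<^esub> \<e>\<^bsub>X\<^esub> A \<oplus>\<^bsub>X\<^esub> \<e>\<^bsub>X\<^esub> A \<otimes>\<^bsub>X\<^esub> \<epsilon>\<^bsub>X\<^esub> A)"

definition induced_unit :: "('o, 'a, 'm) mon_coalg_mod_scheme \<Rightarrow> 'o \<Rightarrow> 'a"  (\<open>\<u>\<index>\<close>)
  where "induced_unit X A = \<m>\<^sub>K\<^bsub>X\<^esub> \<cdot>\<^bsub>X\<^esub> !\<^sub>a\<^bsub>X\<^esub> (\<zero>\<^bsub>X\<^esub> \<K>\<^bsub>X\<^esub> A)"

text \<open>
  Coderelictions with respect to given families \<open>nab A : !A \<otimes> !A \<rightarrow> !A\<close> and \<open>un A : K \<rightarrow> !A\<close>,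
  the multiplication and unit of a bialgebra modality.
\<close>

locale codereliction =
  additive_symmetric_monoidal_category X + coalgebra_modality X
  for X :: "('o, 'a, 'm) coalg_mod_scheme" (structure) +
  fixes nab :: "'o \<Rightarrow> 'a" and un :: "'o \<Rightarrow> 'a" and \<eta> :: "'o \<Rightarrow> 'a"
  assumes Coder_Hom: "A \<in> Ob X \<Longrightarrow> \<eta> A \<in> Hom X A (!\<^sub>o A)"
    and Coder_nat: "f \<in> Hom X A B \<Longrightarrow> f \<cdot> \<eta> B = \<eta> A \<cdot> !\<^sub>a f"
    and constant_rule: "A \<in> Ob X \<Longrightarrow> \<eta> A \<cdot> \<e> A = \<zero> A \<K>"
    and product_rule: "A \<in> Ob X \<Longrightarrow> \<eta> A \<cdot> \<Delta> A = \<eta> A \<otimes> un A \<oplus> un A \<otimes> \<eta> A"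
    and linear_rule: "A \<in> Ob X \<Longrightarrow> \<eta> A \<cdot> \<epsilon> A = \<one> A"
    and chain_rule: "A \<in> Ob X
          \<Longrightarrow> (\<one> (!\<^sub>o A) \<otimes> \<eta> A) \<cdot> nab A \<cdot> \<delta> A
            = (\<Delta> A \<otimes> \<eta> A) \<cdot> (\<one> (!\<^sub>o A) \<otimes> nab A) \<cdot> (\<delta> A \<otimes> \<eta> (!\<^sub>o A)) \<cdot> nab (!\<^sub>o A)"

end

theory Submission
  imports Defs
begin

text \<open>
  With biproducts, \<open>m : !A \<otimes> !B \<rightarrow> !(A \<otimes> B)\<close> is the inverse Seely map followed by
  \<open>\<delta>\<close> at \<open>A \<times> B\<close> and \<open>!g\<close>, where \<open>g : !(A \<times> B) \<rightarrow> A \<otimes> B\<close> is \<open>\<Delta>\<close> followed by the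
  two projections and \<open>\<epsilon>\<close>. Precomposing with \<open>1 \<otimes> \<eta>\<close>, the chain rule at \<open>A \<times> B\<close> splits the
  result into two factors multiplied by \<open>\<nabla>\<close>: the first is trivial because \<open>g\<close> vanishes on \<open>!A\<close>,
  the second is \<open>(\<epsilon> \<otimes> 1) \<eta>\<close>. The argument needs only injections and projections that
  satisfy the four orthogonality equations, and \<open>!A \<otimes> !B\<close> carries such maps.
\<close>

section \<open>Typing, strictness and interchange in symmetric monoidal categories\<close>

context symmetric_monoidal_category
begin

text \<open>From here on typing is tracked by equations for \<open>Dom\<close> and
  \<open>Cod\<close> instead of membership in \<open>Hom\<close>. Composability can then be decided
  by rewriting, with no intermediate object to guess.\<close>

lemma HomD:
  assumes "f \<in> Hom X A B"
  shows "f \<in> Ar X" "Dom X f = A" "Cod X f = B"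
  using assms by (simp_all add: Hom_def)

lemma HomI: "\<lbrakk>f \<in> Ar X; Dom X f = A; Cod X f = B\<rbrakk> \<Longrightarrow> f \<in> Hom X A B"
  by (simp add: Hom_def)

lemma Idn_simps [simp]:
  assumes "A \<in> Ob X"
  shows "\<one> A \<in> Ar X" "Dom X (\<one> A) = A" "Cod X (\<one> A) = A"
  using HomD[OF Idn_Hom[OF assms]] by auto

lemma Cmp_simps [simp]:
  assumes "f \<in> Ar X" "g \<in> Ar X" "Cod X f = Dom X g"
  shows "f \<cdot> g \<in> Ar X" "Dom X (f \<cdot> g) = Dom X f" "Cod X (f \<cdot> g) = Cod X g"
  using HomD[OF Cmp_Hom[OF HomI HomI]] assms by auto

lemma Ten_simps [simp]:
  assumes "f \<in> Ar X" "g \<in> Ar X"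
  shows "f \<otimes> g \<in> Ar X" "Dom X (f \<otimes> g) = Dom X f \<odot> Dom X g"
    "Cod X (f \<otimes> g) = Cod X f \<odot> Cod X g"
  using HomD[OF Ten_Hom[OF HomI HomI]] assms by auto

lemma Sym_simps [simp]:
  assumes "A \<in> Ob X" "B \<in> Ob X"
  shows "\<sigma> A B \<in> Ar X" "Dom X (\<sigma> A B) = A \<odot> B" "Cod X (\<sigma> A B) = B \<odot> A"
  using HomD[OF Sym_Hom[OF assms]] by auto

lemmas Ob_simps [simp] =
  Dom_Ob Cod_Ob TenO_Ob Unit_Ob TenO_assoc TenO_Unit_left TenO_Unit_right

lemma Idn_Cmp [simp]: "\<lbrakk>f \<in> Ar X; Dom X f = A\<rbrakk> \<Longrightarrow> \<one> A \<cdot> f = f"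
  and Cmp_Idn [simp]: "\<lbrakk>f \<in> Ar X; Cod X f = A\<rbrakk> \<Longrightarrow> f \<cdot> \<one> A = f"
  by (rule Idn_left[OF HomI]; simp) (rule Idn_right[OF HomI]; simp)

lemma Cmp_Cmp [simp]:
  "\<lbrakk>f \<in> Ar X; g \<in> Ar X; h \<in> Ar X; Cod X f = Dom X g; Cod X g = Dom X h\<rbrakk>
    \<Longrightarrow> (f \<cdot> g) \<cdot> h = f \<cdot> (g \<cdot> h)"
  by (rule Cmp_assoc[OF HomI HomI HomI]) auto

lemmas Ten_strict_simps [simp] = Ten_assoc Ten_Unit_left Ten_Unit_right Ten_Idn

lemma interchange:
  "\<lbrakk>f \<in> Ar X; f' \<in> Ar X; g \<in> Ar X; g' \<in> Ar X; Cod X f = Dom X f'; Cod X g = Dom X g'\<rbrakk>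
    \<Longrightarrow> (f \<otimes> g) \<cdot> (f' \<otimes> g') = (f \<cdot> f') \<otimes> (g \<cdot> g')"
  by (rule Ten_Cmp[OF HomI HomI HomI HomI, symmetric]) auto

text \<open>Composites are kept nested to the right, so inside a longer chain two neighbouring
  tensors meet only in front of a tail \<open>k\<close>.\<close>

lemma interchange_Cmp:
  assumes "f \<in> Ar X" "f' \<in> Ar X" "g \<in> Ar X" "g' \<in> Ar X" "k \<in> Ar X"
    "Cod X f = Dom X f'" "Cod X g = Dom X g'" "Cod X f' \<odot> Cod X g' = Dom X k"
  shows "(f \<otimes> g) \<cdot> ((f' \<otimes> g') \<cdot> k) = ((f \<cdot> f') \<otimes> (g \<cdot> g')) \<cdot> k"
  using assms by (subst Cmp_Cmp[symmetric]) (auto simp: interchange)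

text \<open>The hexagon at the unit makes the symmetry idempotent, hence the identity.\<close>

lemma Sym_Unit [simp]: "\<sigma> \<K> \<K> = \<one> \<K>"
proof -
  have "\<sigma> \<K> \<K> = \<sigma> \<K> \<K> \<cdot> \<sigma> \<K> \<K>"
    using Sym_hexagon[of \<K> \<K> \<K>] by simp
  then show ?thesis using Sym_Sym[of \<K> \<K>] by simp
qed

end

section \<open>Sums and zero maps\<close>

context additive_symmetric_monoidal_category
begin

lemma Plus_simps [simp]:
  assumes "f \<in> Ar X" "g \<in> Ar X" "Dom X f = Dom X g" "Cod X f = Cod X g"
  shows "f \<oplus> g \<in> Ar X" "Dom X (f \<oplus> g) = Dom X g" "Cod X (f \<oplus> g) = Cod X g"
  using HomD[OF Plus_Hom[OF HomI HomI]] assms by auto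

lemma Zero_simps [simp]:
  assumes "A \<in> Ob X" "B \<in> Ob X"
  shows "\<zero> A B \<in> Ar X" "Dom X (\<zero> A B) = A" "Cod X (\<zero> A B) = B"
  using HomD[OF Zero_Hom[OF assms]] by auto

lemma Plus_Zero_simps [simp]:
  assumes "f \<in> Ar X" "Dom X f = A" "Cod X f = B"
  shows "f \<oplus> \<zero> A B = f" "\<zero> A B \<oplus> f = f"
proof -
  have f: "f \<in> Hom X A B" by (rule HomI[OF assms])
  have AB: "A \<in> Ob X" "B \<in> Ob X" using assms by auto
  show "f \<oplus> \<zero> A B = f" by (rule Plus_Zero[OF f])
  then show "\<zero> A B \<oplus> f = f" using Plus_comm[OF Zero_Hom[OF AB] f] by simp
qed

lemma Cmp_Plus:
  "\<lbrakk>f \<in> Ar X; g \<in> Ar X; h \<in> Ar X; Dom X f = Dom X g; Cod X f = Cod X g; Cod X g = Dom X h\<rbrakk>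
    \<Longrightarrow> (f \<oplus> g) \<cdot> h = (f \<cdot> h) \<oplus> (g \<cdot> h)"
  "\<lbrakk>f \<in> Ar X; g \<in> Ar X; h \<in> Ar X; Dom X g = Dom X h; Cod X g = Cod X h; Cod X f = Dom X h\<rbrakk>
    \<Longrightarrow> f \<cdot> (g \<oplus> h) = (f \<cdot> g) \<oplus> (f \<cdot> h)"
  by (rule Cmp_Plus_left[OF HomI HomI HomI]; simp)
    (rule Cmp_Plus_right[OF HomI HomI HomI]; simp)

lemma Cmp_Zero [simp]:
  "\<lbrakk>A \<in> Ob X; f \<in> Ar X; Dom X f = B\<rbrakk> \<Longrightarrow> \<zero> A B \<cdot> f = \<zero> A (Cod X f)"
  "\<lbrakk>f \<in> Ar X; Cod X f = B; C \<in> Ob X\<rbrakk> \<Longrightarrow> f \<cdot> \<zero> B C = \<zero> (Dom X f) C"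
  by (rule Cmp_Zero_left[OF _ HomI]; simp) (rule Cmp_Zero_right[OF HomI]; simp)

lemma Ten_Zero [simp]:
  "\<lbrakk>A \<in> Ob X; B \<in> Ob X; f \<in> Ar X\<rbrakk> \<Longrightarrow> \<zero> A B \<otimes> f = \<zero> (A \<odot> Dom X f) (B \<odot> Cod X f)"
  "\<lbrakk>A \<in> Ob X; B \<in> Ob X; f \<in> Ar X\<rbrakk> \<Longrightarrow> f \<otimes> \<zero> A B = \<zero> (Dom X f \<odot> A) (Cod X f \<odot> B)"
  by (rule Ten_Zero_left[OF _ _ HomI]; simp) (rule Ten_Zero_right[OF HomI]; simp)

end

section \<open>Naturality and counit laws of the modality\<close>

context coalgebra_modality
begin

lemmas BangO_Ob_simp [simp] = BangO_Ob

lemma Bang_simps [simp]: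
  assumes "f \<in> Ar X"
  shows "!\<^sub>a f \<in> Ar X" "Dom X (!\<^sub>a f) = !\<^sub>o (Dom X f)" "Cod X (!\<^sub>a f) = !\<^sub>o (Cod X f)"
  using HomD[OF Bang_Hom[OF HomI]] assms by auto

lemma modality_simps [simp]:
  assumes "A \<in> Ob X"
  shows "\<delta> A \<in> Ar X" "Dom X (\<delta> A) = !\<^sub>o A" "Cod X (\<delta> A) = !\<^sub>o (!\<^sub>o A)"
    and "\<epsilon> A \<in> Ar X" "Dom X (\<epsilon> A) = !\<^sub>o A" "Cod X (\<epsilon> A) = A"
    and "\<Delta> A \<in> Ar X" "Dom X (\<Delta> A) = !\<^sub>o A" "Cod X (\<Delta> A) = !\<^sub>o A \<odot> !\<^sub>o A"
    and "\<e> A \<in> Ar X" "Dom X (\<e> A) = !\<^sub>o A" "Cod X (\<e> A) = \<K>"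
  using HomD[OF Dig_Hom[OF assms]] HomD[OF Der_Hom[OF assms]]
    HomD[OF Comul_Hom[OF assms]] HomD[OF Couni_Hom[OF assms]] by auto

lemma Bang_Cmp': "\<lbrakk>f \<in> Ar X; g \<in> Ar X; Cod X f = Dom X g\<rbrakk> \<Longrightarrow> !\<^sub>a f \<cdot> !\<^sub>a g = !\<^sub>a (f \<cdot> g)"
  by (rule Bang_Cmp[OF HomI HomI, symmetric]) auto

lemma Bang_nat:
  assumes "f \<in> Ar X" "Cod X f = B"
  shows "!\<^sub>a f \<cdot> \<delta> B = \<delta> (Dom X f) \<cdot> !\<^sub>a (!\<^sub>a f)"
    and "!\<^sub>a f \<cdot> \<epsilon> B = \<epsilon> (Dom X f) \<cdot> f"
    and "!\<^sub>a f \<cdot> \<Delta> B = \<Delta> (Dom X f) \<cdot> (!\<^sub>a f \<otimes> !\<^sub>a f)"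
    and "!\<^sub>a f \<cdot> \<e> B = \<e> (Dom X f)"
  using assms Dig_nat Der_nat Comul_nat Couni_nat HomI by metis+

text \<open>The counit laws of the comonoid, followed by \<open>\<epsilon> A\<close>. By strictness
  \<open>\<epsilon> A\<close> is its own tensor with \<open>\<one> \<K>\<close>, and in that form
  interchange applies.\<close>

lemma Comul_Der_Couni:
  assumes [simp]: "A \<in> Ob X"
  shows "\<Delta> A \<cdot> (\<epsilon> A \<otimes> \<e> A) = \<epsilon> A" "\<Delta> A \<cdot> (\<e> A \<otimes> \<epsilon> A) = \<epsilon> A"
proof -
  have "\<epsilon> A = (\<Delta> A \<cdot> (\<one> (!\<^sub>o A) \<otimes> \<e> A)) \<cdot> (\<epsilon> A \<otimes> \<one> \<K>)"
    using Comul_Couni_right[of A] by simp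
  also have "\<dots> = \<Delta> A \<cdot> (\<epsilon> A \<otimes> \<e> A)"
    by (subst Cmp_Cmp) (simp_all add: interchange del: Ten_strict_simps)
  finally show "\<Delta> A \<cdot> (\<epsilon> A \<otimes> \<e> A) = \<epsilon> A" by simp
  have "\<epsilon> A = (\<Delta> A \<cdot> (\<e> A \<otimes> \<one> (!\<^sub>o A))) \<cdot> (\<one> \<K> \<otimes> \<epsilon> A)"
    using Comul_Couni_left[of A] by simp
  also have "\<dots> = \<Delta> A \<cdot> (\<e> A \<otimes> \<epsilon> A)"
    by (subst Cmp_Cmp) (simp_all add: interchange del: Ten_strict_simps)
  finally show "\<Delta> A \<cdot> (\<e> A \<otimes> \<epsilon> A) = \<epsilon> A" by simp
qed

end

section \<open>Coextensions along the coalgebra on a tensor of two cofree coalgebras\<close>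

context monoidal_coalgebra_modality
begin

lemma Mon_simps [simp]:
  assumes "A \<in> Ob X" "B \<in> Ob X"
  shows "\<m>\<^sub>\<otimes> A B \<in> Ar X" "Dom X (\<m>\<^sub>\<otimes> A B) = !\<^sub>o A \<odot> !\<^sub>o B" "Cod X (\<m>\<^sub>\<otimes> A B) = !\<^sub>o (A \<odot> B)"
  using HomD[OF Mon_Hom[OF assms]] by auto

lemma MonU_simps [simp]: "\<m>\<^sub>K \<in> Ar X" "Dom X \<m>\<^sub>K = \<K>" "Cod X \<m>\<^sub>K = !\<^sub>o \<K>"
  using HomD[OF MonU_Hom] by auto

lemma Mon_nat':
  "\<lbrakk>f \<in> Ar X; g \<in> Ar X; Cod X f = A; Cod X g = B\<rbrakk>
    \<Longrightarrow> (!\<^sub>a f \<otimes> !\<^sub>a g) \<cdot> \<m>\<^sub>\<otimes> A B = \<m>\<^sub>\<otimes> (Dom X f) (Dom X g) \<cdot> !\<^sub>a (f \<otimes> g)"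
  by (rule Mon_nat[OF HomI HomI]) auto

text \<open>
  \<open>coext A B x\<close> is the coextension of \<open>x : !A \<otimes> !B \<rightarrow> Z\<close> along the coalgebra
  \<open>(\<delta> \<otimes> \<delta>) m : !A \<otimes> !B \<rightarrow> !(!A \<otimes> !B)\<close>.
\<close>

definition coext :: "'o \<Rightarrow> 'o \<Rightarrow> 'a \<Rightarrow> 'a"
  where "coext A B x = (\<delta> A \<otimes> \<delta> B) \<cdot> \<m>\<^sub>\<otimes> (!\<^sub>o A) (!\<^sub>o B) \<cdot> !\<^sub>a x"

context
  fixes A B x
  assumes A [simp]: "A \<in> Ob X" and B [simp]: "B \<in> Ob X"
    and x [simp]: "x \<in> Ar X" "Dom X x = !\<^sub>o A \<odot> !\<^sub>o B"
begin

lemma coext_simps [simp]: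
  "coext A B x \<in> Ar X" "Dom X (coext A B x) = !\<^sub>o A \<odot> !\<^sub>o B" "Cod X (coext A B x) = !\<^sub>o (Cod X x)"
  by (simp_all add: coext_def)

lemma coext_Bang:
  "\<lbrakk>y \<in> Ar X; Cod X x = Dom X y\<rbrakk> \<Longrightarrow> coext A B x \<cdot> !\<^sub>a y = coext A B (x \<cdot> y)"
  by (simp add: coext_def Bang_Cmp')

text \<open>By naturality of \<open>\<delta>\<close> and of the monoidal structure,
  \<open>!\<^sub>a f \<otimes> !\<^sub>a g\<close> is a coalgebra morphism, and coextensions absorb
  coalgebra morphisms on the left.\<close>

lemma Bang_coext:
  assumes "f \<in> Ar X" "g \<in> Ar X" "Cod X f = A" "Cod X g = B"
  shows "(!\<^sub>a f \<otimes> !\<^sub>a g) \<cdot> coext A B x = coext (Dom X f) (Dom X g) ((!\<^sub>a f \<otimes> !\<^sub>a g) \<cdot> x)"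
proof -
  have "(!\<^sub>a f \<otimes> !\<^sub>a g) \<cdot> coext A B x
      = (\<delta> (Dom X f) \<otimes> \<delta> (Dom X g)) \<cdot> (((!\<^sub>a (!\<^sub>a f) \<otimes> !\<^sub>a (!\<^sub>a g)) \<cdot> \<m>\<^sub>\<otimes> (!\<^sub>o A) (!\<^sub>o B)) \<cdot> !\<^sub>a x)"
    using assms by (simp add: coext_def interchange_Cmp Bang_nat)
  then show ?thesis
    using assms by (subst (asm) Mon_nat') (simp_all add: coext_def Bang_Cmp')
qed

text \<open>The counit law of the coalgebra: \<open>\<epsilon>\<close> is monoidal, and
  \<open>\<delta>\<close> followed by \<open>\<epsilon>\<close> is the identity on each
  factor.\<close>

lemma coext_Der: "coext A B x \<cdot> \<epsilon> (Cod X x) = x"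
proof -
  have "coext A B x \<cdot> \<epsilon> (Cod X x)
      = (\<delta> A \<otimes> \<delta> B) \<cdot> ((\<m>\<^sub>\<otimes> (!\<^sub>o A) (!\<^sub>o B) \<cdot> \<epsilon> (!\<^sub>o A \<odot> !\<^sub>o B)) \<cdot> x)"
    by (simp add: coext_def Bang_nat)
  then show ?thesis
    by (subst (asm) Mon_Der) (simp_all add: interchange_Cmp Dig_Der)
qed

text \<open>Coassociativity of the coalgebra, from monoidality of \<open>\<delta>\<close> and the
  comonad law in each factor. It makes a coextension a coalgebra morphism into the cofree
  coalgebra.\<close>

lemma coext_Dig: "coext A B x \<cdot> \<delta> (Cod X x) = coext A B (coext A B x)"
proof -
  let ?m = "\<m>\<^sub>\<otimes> (!\<^sub>o A) (!\<^sub>o B)"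
  have "coext A B x \<cdot> \<delta> (Cod X x)
      = (\<delta> A \<otimes> \<delta> B) \<cdot> ((?m \<cdot> \<delta> (!\<^sub>o A \<odot> !\<^sub>o B)) \<cdot> !\<^sub>a (!\<^sub>a x))"
    by (simp add: coext_def Bang_nat)
  also have "\<dots> = (\<delta> A \<otimes> \<delta> B) \<cdot> (((!\<^sub>a (\<delta> A) \<otimes> !\<^sub>a (\<delta> B)) \<cdot> \<m>\<^sub>\<otimes> (!\<^sub>o (!\<^sub>o A)) (!\<^sub>o (!\<^sub>o B)))
      \<cdot> !\<^sub>a (?m \<cdot> !\<^sub>a x))"
    by (simp add: Mon_Dig interchange_Cmp Dig_Dig Bang_Cmp')
  also have "\<dots> = coext A B (coext A B x)"
    by (subst Mon_nat') (simp_all add: coext_def Bang_Cmp')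
  finally show ?thesis .
qed

text \<open>Coextensions respect comultiplication, where the source carries the tensor of two
  comonoids: this holds for \<open>\<delta>\<close>, for the monoidal structure map and for
  \<open>!\<^sub>a x\<close> separately.\<close>

lemma coext_Comul:
  "coext A B x \<cdot> \<Delta> (Cod X x)
    = (\<Delta> A \<otimes> \<Delta> B) \<cdot> (\<one> (!\<^sub>o A) \<otimes> \<sigma> (!\<^sub>o A) (!\<^sub>o B) \<otimes> \<one> (!\<^sub>o B))
      \<cdot> (coext A B x \<otimes> coext A B x)"
proof -
  let ?m = "\<m>\<^sub>\<otimes> (!\<^sub>o A) (!\<^sub>o B)"
  let ?k = "?m \<cdot> !\<^sub>a x"
  let ?s = "\<lambda>A B. \<one> (!\<^sub>o A) \<otimes> \<sigma> (!\<^sub>o A) (!\<^sub>o B) \<otimes> \<one> (!\<^sub>o B)"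
  \<comment> \<open>Naturality of \<open>\<sigma>\<close> carries the middle exchange past the four
    copies of \<open>\<delta>\<close>.\<close>
  have swap: "((\<delta> A \<otimes> \<delta> A) \<otimes> (\<delta> B \<otimes> \<delta> B)) \<cdot> ?s (!\<^sub>o A) (!\<^sub>o B)
      = ?s A B \<cdot> ((\<delta> A \<otimes> \<delta> B) \<otimes> (\<delta> A \<otimes> \<delta> B))"
  proof -
    have "((\<delta> A \<otimes> \<delta> A) \<otimes> (\<delta> B \<otimes> \<delta> B)) \<cdot> ?s (!\<^sub>o A) (!\<^sub>o B)
        = (\<delta> A \<otimes> ((\<delta> A \<otimes> \<delta> B) \<otimes> \<delta> B)) \<cdot> ?s (!\<^sub>o A) (!\<^sub>o B)"
      by simp
    also have "\<dots> = \<delta> A \<otimes> (((\<delta> A \<otimes> \<delta> B) \<cdot> \<sigma> (!\<^sub>o (!\<^sub>o A)) (!\<^sub>o (!\<^sub>o B))) \<otimes> \<delta> B)"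
      by (simp add: interchange del: Ten_strict_simps)
    also have "\<dots> = \<delta> A \<otimes> ((\<sigma> (!\<^sub>o A) (!\<^sub>o B) \<cdot> (\<delta> B \<otimes> \<delta> A)) \<otimes> \<delta> B)"
      by (subst Sym_nat[OF Dig_Hom Dig_Hom]) auto
    also have "\<dots> = ?s A B \<cdot> (\<delta> A \<otimes> ((\<delta> B \<otimes> \<delta> A) \<otimes> \<delta> B))"
      by (simp add: interchange del: Ten_strict_simps)
    finally show ?thesis by simp
  qed
  have "coext A B x \<cdot> \<Delta> (Cod X x)
      = (\<delta> A \<otimes> \<delta> B) \<cdot> ((?m \<cdot> \<Delta> (!\<^sub>o A \<odot> !\<^sub>o B)) \<cdot> (!\<^sub>a x \<otimes> !\<^sub>a x))"
    by (simp add: coext_def Bang_nat)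
  also have "\<dots> = ((\<delta> A \<otimes> \<delta> B) \<cdot> (\<Delta> (!\<^sub>o A) \<otimes> \<Delta> (!\<^sub>o B))) \<cdot> (?s (!\<^sub>o A) (!\<^sub>o B) \<cdot> (?k \<otimes> ?k))"
    by (simp add: Mon_Comul interchange interchange_Cmp)
  also have "(\<delta> A \<otimes> \<delta> B) \<cdot> (\<Delta> (!\<^sub>o A) \<otimes> \<Delta> (!\<^sub>o B))
      = (\<Delta> A \<otimes> \<Delta> B) \<cdot> ((\<delta> A \<otimes> \<delta> A) \<otimes> (\<delta> B \<otimes> \<delta> B))"
    by (simp add: interchange Dig_Comul del: Ten_strict_simps)
  also have "\<dots> \<cdot> (?s (!\<^sub>o A) (!\<^sub>o B) \<cdot> (?k \<otimes> ?k))
      = (\<Delta> A \<otimes> \<Delta> B) \<cdot> ((((\<delta> A \<otimes> \<delta> A) \<otimes> (\<delta> B \<otimes> \<delta> B)) \<cdot> ?s (!\<^sub>o A) (!\<^sub>o B)) \<cdot> (?k \<otimes> ?k))"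
    by (simp del: Ten_strict_simps)
  also have "\<dots> = (\<Delta> A \<otimes> \<Delta> B) \<cdot> (?s A B \<cdot> (((\<delta> A \<otimes> \<delta> B) \<otimes> (\<delta> A \<otimes> \<delta> B)) \<cdot> (?k \<otimes> ?k)))"
    unfolding swap by (simp del: Ten_strict_simps)
  also have "\<dots> = (\<Delta> A \<otimes> \<Delta> B) \<cdot> (?s A B \<cdot> (coext A B x \<otimes> coext A B x))"
    by (simp add: interchange coext_def del: Ten_strict_simps)
  finally show ?thesis by simp
qed

end

text \<open>Insert \<open>\<delta>\<close> followed by \<open>!\<^sub>a \<epsilon>\<close>, an
  identity, in each factor; naturality then moves both derelictions behind the monoidal map.\<close>

lemma Mon_eq_coext:
  assumes [simp]: "A \<in> Ob X" "B \<in> Ob X"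
  shows "\<m>\<^sub>\<otimes> A B = coext A B (\<epsilon> A \<otimes> \<epsilon> B)"
proof -
  have "\<m>\<^sub>\<otimes> A B = (\<delta> A \<otimes> \<delta> B) \<cdot> ((!\<^sub>a (\<epsilon> A) \<otimes> !\<^sub>a (\<epsilon> B)) \<cdot> \<m>\<^sub>\<otimes> A B)"
    by (simp add: interchange_Cmp Dig_Bang_Der)
  also have "(!\<^sub>a (\<epsilon> A) \<otimes> !\<^sub>a (\<epsilon> B)) \<cdot> \<m>\<^sub>\<otimes> A B = \<m>\<^sub>\<otimes> (!\<^sub>o A) (!\<^sub>o B) \<cdot> !\<^sub>a (\<epsilon> A \<otimes> \<epsilon> B)"
    by (subst Mon_nat') simp_all
  finally show ?thesis by (simp add: coext_def)
qed

text \<open>Duplicate both arguments, then keep the first from one pair of copies and the second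
  from the other. This evaluates the inverse Seely map followed by \<open>g\<close> below.\<close>

lemma swap_counits:
  assumes [simp]: "A \<in> Ob X" "B \<in> Ob X"
  shows "(\<Delta> A \<otimes> \<Delta> B) \<cdot> (\<one> (!\<^sub>o A) \<otimes> \<sigma> (!\<^sub>o A) (!\<^sub>o B) \<otimes> \<one> (!\<^sub>o B))
      \<cdot> ((\<epsilon> A \<otimes> \<e> B) \<otimes> (\<e> A \<otimes> \<epsilon> B)) = \<epsilon> A \<otimes> \<epsilon> B"
proof -
  have "(\<one> (!\<^sub>o A) \<otimes> \<sigma> (!\<^sub>o A) (!\<^sub>o B) \<otimes> \<one> (!\<^sub>o B)) \<cdot> ((\<epsilon> A \<otimes> \<e> B) \<otimes> (\<e> A \<otimes> \<epsilon> B))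
      = (\<one> (!\<^sub>o A) \<otimes> \<sigma> (!\<^sub>o A) (!\<^sub>o B) \<otimes> \<one> (!\<^sub>o B)) \<cdot> (\<epsilon> A \<otimes> ((\<e> B \<otimes> \<e> A) \<otimes> \<epsilon> B))"
    by simp
  also have "\<dots> = \<epsilon> A \<otimes> ((\<sigma> (!\<^sub>o A) (!\<^sub>o B) \<cdot> (\<e> B \<otimes> \<e> A)) \<otimes> \<epsilon> B)"
    by (simp add: interchange del: Ten_strict_simps)
  \<comment> \<open>The exchange disappears because both counits land in \<open>\<K>\<close>, where
    the symmetry is the identity.\<close>
  also have "\<sigma> (!\<^sub>o A) (!\<^sub>o B) \<cdot> (\<e> B \<otimes> \<e> A) = \<e> A \<otimes> \<e> B"
    using Sym_nat[OF Couni_Hom[of A] Couni_Hom[of B]] by simp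
  also have "\<epsilon> A \<otimes> ((\<e> A \<otimes> \<e> B) \<otimes> \<epsilon> B) = (\<epsilon> A \<otimes> \<e> A) \<otimes> (\<e> B \<otimes> \<epsilon> B)"
    by simp
  finally show ?thesis
    by (simp add: interchange Comul_Der_Couni del: Ten_strict_simps)
qed

end

section \<open>The induced multiplication and unit\<close>

context additive_linear_category
begin

lemma induced_mult_eq_coext: "\<nabla> A = coext A A (\<epsilon> A \<otimes> \<e> A \<oplus> \<e> A \<otimes> \<epsilon> A)"
  by (simp add: induced_mult_def coext_def)

lemma induced_mult_simps [simp]:
  assumes "A \<in> Ob X"
  shows "\<nabla> A \<in> Ar X" "Dom X (\<nabla> A) = !\<^sub>o A \<odot> !\<^sub>o A" "Cod X (\<nabla> A) = !\<^sub>o A"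
  using assms by (simp_all add: induced_mult_eq_coext)

lemma induced_unit_simps [simp]:
  assumes "A \<in> Ob X"
  shows "\<u> A \<in> Ar X" "Dom X (\<u> A) = \<K>" "Cod X (\<u> A) = !\<^sub>o A"
  using assms by (simp_all add: induced_unit_def)

text \<open>A coalgebra morphism followed by the coextension \<open>\<nabla> A\<close> is again a
  coextension; naturality of \<open>\<epsilon>\<close> and \<open>\<e>\<close> computes the new map.
  This is how the inverse Seely map becomes a coextension.\<close>

lemma Bang_induced_mult:
  assumes [simp]: "f \<in> Ar X" "g \<in> Ar X" "Cod X f = A" "Cod X g = A" "A \<in> Ob X"
  shows "(!\<^sub>a f \<otimes> !\<^sub>a g) \<cdot> \<nabla> A = coext (Dom X f) (Dom X g)
    ((\<epsilon> (Dom X f) \<cdot> f) \<otimes> \<e> (Dom X g) \<oplus> \<e> (Dom X f) \<otimes> (\<epsilon> (Dom X g) \<cdot> g))"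
  by (simp add: induced_mult_eq_coext Bang_coext Cmp_Plus interchange Bang_nat)

text \<open>Both sides are coextensions of the same map. To see this, \<open>f\<close> is tensored
  with \<open>\<one> \<K>\<close> on either side, so that it composes with each summand.\<close>

lemma induced_mult_nat:
  assumes [simp]: "f \<in> Ar X" "Cod X f = A"
  shows "(!\<^sub>a f \<otimes> !\<^sub>a f) \<cdot> \<nabla> A = \<nabla> (Dom X f) \<cdot> !\<^sub>a f"
proof -
  have [simp]: "A \<in> Ob X" using Cod_Ob[of f] by simp
  have 1: "(\<epsilon> (Dom X f) \<otimes> \<e> (Dom X f)) \<cdot> f = (\<epsilon> (Dom X f) \<cdot> f) \<otimes> \<e> (Dom X f)"
    using interchange[of "\<epsilon> (Dom X f)" f "\<e> (Dom X f)" "\<one> \<K>"] by simp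
  have 2: "(\<e> (Dom X f) \<otimes> \<epsilon> (Dom X f)) \<cdot> f = \<e> (Dom X f) \<otimes> (\<epsilon> (Dom X f) \<cdot> f)"
    using interchange[of "\<e> (Dom X f)" "\<one> \<K>" "\<epsilon> (Dom X f)" f] by simp
  show ?thesis
    by (subst Bang_induced_mult) (simp_all add: induced_mult_eq_coext coext_Bang Cmp_Plus 1 2)
qed

lemma induced_unit_Couni [simp]: "A \<in> Ob X \<Longrightarrow> \<u> A \<cdot> \<e> A = \<one> \<K>"
  by (simp add: induced_unit_def Bang_nat MonU_Couni)

lemma induced_unit_Der [simp]: "A \<in> Ob X \<Longrightarrow> \<u> A \<cdot> \<epsilon> A = \<zero> \<K> A"
  by (simp add: induced_unit_def Bang_nat)

text \<open>\<open>\<u> A\<close> is a coalgebra morphism from \<open>\<K>\<close> with structure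
  \<open>\<m>\<^sub>K\<close>, being the coextension of zero along it.\<close>

lemma induced_unit_Dig:
  assumes [simp]: "A \<in> Ob X"
  shows "\<u> A \<cdot> \<delta> A = \<m>\<^sub>K \<cdot> !\<^sub>a (\<u> A)"
proof -
  have "\<u> A \<cdot> \<delta> A = (\<m>\<^sub>K \<cdot> \<delta> \<K>) \<cdot> !\<^sub>a (!\<^sub>a (\<zero> \<K> A))"
    by (simp add: induced_unit_def Bang_nat)
  then show ?thesis by (subst (asm) MonU_Dig) (simp add: induced_unit_def Bang_Cmp')
qed

text \<open>Since \<open>\<u> A\<close> is a coalgebra morphism, it can be moved inside the
  coextension. The monoidal unit law then removes \<open>\<m>\<^sub>K\<close>, and what is left is
  \<open>\<delta> A\<close> followed by \<open>!\<^sub>a (\<epsilon> A)\<close>.\<close>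

lemma induced_unit_mult:
  assumes [simp]: "A \<in> Ob X"
  shows "(\<u> A \<otimes> \<one> (!\<^sub>o A)) \<cdot> \<nabla> A = \<one> (!\<^sub>o A)"
proof -
  let ?a = "\<epsilon> A \<otimes> \<e> A \<oplus> \<e> A \<otimes> \<epsilon> A"
  let ?m = "\<m>\<^sub>\<otimes> (!\<^sub>o A) (!\<^sub>o A)"
  \<comment> \<open>Dereliction kills the unit, so the first summand vanishes; the counit turns it
    into \<open>\<one> \<K>\<close>, so the second survives.\<close>
  have "(\<u> A \<otimes> \<one> (!\<^sub>o A)) \<cdot> ?a = \<epsilon> A"
    by (simp add: Cmp_Plus interchange)
  then have a: "!\<^sub>a (\<u> A \<otimes> \<one> (!\<^sub>o A)) \<cdot> !\<^sub>a ?a = !\<^sub>a (\<epsilon> A)"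
    by (simp add: Bang_Cmp')
  have "(\<u> A \<otimes> \<one> (!\<^sub>o A)) \<cdot> \<nabla> A = ((\<m>\<^sub>K \<cdot> !\<^sub>a (\<u> A)) \<otimes> (\<delta> A \<cdot> !\<^sub>a (\<one> (!\<^sub>o A)))) \<cdot> (?m \<cdot> !\<^sub>a ?a)"
    by (simp add: induced_mult_eq_coext coext_def interchange_Cmp induced_unit_Dig Bang_Idn)
  also have "\<dots> = (\<m>\<^sub>K \<otimes> \<delta> A) \<cdot> (((!\<^sub>a (\<u> A) \<otimes> !\<^sub>a (\<one> (!\<^sub>o A))) \<cdot> ?m) \<cdot> !\<^sub>a ?a)"
    by (simp add: interchange_Cmp)
  also have "\<dots> = (\<m>\<^sub>K \<otimes> \<delta> A) \<cdot> (\<m>\<^sub>\<otimes> \<K> (!\<^sub>o A) \<cdot> !\<^sub>a (\<epsilon> A))"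
    by (subst Mon_nat') (simp_all add: a)
  also have "\<dots> = (\<one> \<K> \<otimes> \<delta> A) \<cdot> (((\<m>\<^sub>K \<otimes> \<one> (!\<^sub>o (!\<^sub>o A))) \<cdot> \<m>\<^sub>\<otimes> \<K> (!\<^sub>o A)) \<cdot> !\<^sub>a (\<epsilon> A))"
    by (simp add: interchange_Cmp del: Ten_strict_simps)
  also have "\<dots> = \<one> (!\<^sub>o A)"
    by (subst Mon_unit_left) (simp_all add: Dig_Bang_Der)
  finally show ?thesis .
qed

text \<open>The zero map factors through \<open>\<e> A\<close>, which is a coalgebra morphism to
  \<open>\<K>\<close>.\<close>

lemma Dig_Bang_Zero:
  assumes [simp]: "A \<in> Ob X" "B \<in> Ob X"
  shows "\<delta> A \<cdot> !\<^sub>a (\<zero> (!\<^sub>o A) B) = \<e> A \<cdot> \<u> B"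
proof -
  have "\<delta> A \<cdot> !\<^sub>a (\<zero> (!\<^sub>o A) B) = (\<delta> A \<cdot> !\<^sub>a (\<e> A)) \<cdot> !\<^sub>a (\<zero> \<K> B)"
    by (simp add: Bang_Cmp')
  then show ?thesis by (subst (asm) Dig_Bang_Couni) (simp_all add: induced_unit_def)
qed

end

section \<open>Coderelictions and the monoidal rule\<close>

locale additive_linear_category_with_codereliction =
  additive_linear_category X + codereliction X "induced_mult X" "induced_unit X" \<eta>
  for X :: "('o, 'a, 'm) mon_coalg_mod_scheme" (structure) and \<eta> :: "'o \<Rightarrow> 'a"
begin

lemma Coder_simps [simp]:
  assumes "A \<in> Ob X"
  shows "\<eta> A \<in> Ar X" "Dom X (\<eta> A) = A" "Cod X (\<eta> A) = !\<^sub>o A"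
  using HomD[OF Coder_Hom[OF assms]] by auto

lemma Coder_Bang: "\<lbrakk>f \<in> Ar X; Dom X f = A\<rbrakk> \<Longrightarrow> \<eta> A \<cdot> !\<^sub>a f = f \<cdot> \<eta> (Cod X f)"
  by (rule Coder_nat[OF HomI, symmetric]) auto

text \<open>
  \<open>C\<close> stands for the biproduct of \<open>A\<close> and \<open>B\<close>, for which \<open>p \<cdot> i \<oplus> q \<cdot> j = \<one> C\<close> would
  hold too. In the proof \<open>w\<close> plays the role of the inverse Seely map.
\<close>

lemma monoidal_rule_of_weak_biproduct:
  assumes [simp]: "A \<in> Ob X" "B \<in> Ob X" "C \<in> Ob X"
    and [simp]: "i \<in> Ar X" "Dom X i = A" "Cod X i = C" "j \<in> Ar X" "Dom X j = B" "Cod X j = C"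
    and [simp]: "p \<in> Ar X" "Dom X p = C" "Cod X p = A" "q \<in> Ar X" "Dom X q = C" "Cod X q = B"
    and [simp]: "i \<cdot> p = \<one> A" "i \<cdot> q = \<zero> A B" "j \<cdot> p = \<zero> B A" "j \<cdot> q = \<one> B"
  shows "(\<one> (!\<^sub>o A) \<otimes> \<eta> B) \<cdot> \<m>\<^sub>\<otimes> A B = (\<epsilon> A \<otimes> \<one> B) \<cdot> \<eta> (A \<odot> B)"
proof -
  define g where "g = \<Delta> C \<cdot> ((\<epsilon> C \<cdot> p) \<otimes> (\<epsilon> C \<cdot> q))"
  \<comment> \<open>\<open>s\<close> is the map of which \<open>w\<close> is the coextension; it
    sums the two injections, each applied to one argument while the other is discarded.\<close>
  define s where "s = (\<epsilon> A \<cdot> i) \<otimes> \<e> B \<oplus> \<e> A \<otimes> (\<epsilon> B \<cdot> j)"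
  define w where "w = (!\<^sub>a i \<otimes> !\<^sub>a j) \<cdot> \<nabla> C"
  have g [simp]: "g \<in> Ar X" "Dom X g = !\<^sub>o C" "Cod X g = A \<odot> B"
    by (simp_all add: g_def)
  have s [simp]: "s \<in> Ar X" "Dom X s = !\<^sub>o A \<odot> !\<^sub>o B" "Cod X s = C"
    by (simp_all add: s_def)
  have w: "w = coext A B s"
    by (simp add: w_def s_def Bang_induced_mult)
  have sp: "s \<cdot> p = \<epsilon> A \<otimes> \<e> B"
  proof -
    \<comment> \<open>Tensoring \<open>p\<close> with \<open>\<one> \<K>\<close> lets it act on the
      one nontrivial factor of each summand, where the orthogonality equations decide the
      result.\<close>
    have "((\<epsilon> A \<cdot> i) \<otimes> \<e> B) \<cdot> p = ((\<epsilon> A \<cdot> i) \<otimes> \<e> B) \<cdot> (p \<otimes> \<one> \<K>)"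
      and "(\<e> A \<otimes> (\<epsilon> B \<cdot> j)) \<cdot> p = (\<e> A \<otimes> (\<epsilon> B \<cdot> j)) \<cdot> (\<one> \<K> \<otimes> p)"
      by simp_all
    then show ?thesis
      by (simp add: s_def Cmp_Plus interchange del: Ten_strict_simps)
  qed
  have sq: "s \<cdot> q = \<e> A \<otimes> \<epsilon> B"
  proof -
    have "((\<epsilon> A \<cdot> i) \<otimes> \<e> B) \<cdot> q = ((\<epsilon> A \<cdot> i) \<otimes> \<e> B) \<cdot> (q \<otimes> \<one> \<K>)"
      and "(\<e> A \<otimes> (\<epsilon> B \<cdot> j)) \<cdot> q = (\<e> A \<otimes> (\<epsilon> B \<cdot> j)) \<cdot> (\<one> \<K> \<otimes> q)"
      by simp_all
    then show ?thesis
      by (simp add: s_def Cmp_Plus interchange del: Ten_strict_simps)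
  qed
  \<comment> \<open>\<open>w\<close> respects \<open>\<Delta>\<close>, so the two projections in
    \<open>g\<close> act on separate copies of \<open>s\<close>.\<close>
  have wg: "w \<cdot> g = \<epsilon> A \<otimes> \<epsilon> B"
  proof -
    have wC: "w \<cdot> \<Delta> C = (\<Delta> A \<otimes> \<Delta> B) \<cdot> (\<one> (!\<^sub>o A) \<otimes> \<sigma> (!\<^sub>o A) (!\<^sub>o B) \<otimes> \<one> (!\<^sub>o B)) \<cdot> (w \<otimes> w)"
      using coext_Comul[of A B s] by (simp add: w)
    have "w \<cdot> \<epsilon> C = s"
      using coext_Der[of A B s] by (simp add: w)
    then have "w \<cdot> (\<epsilon> C \<cdot> p) = \<epsilon> A \<otimes> \<e> B" "w \<cdot> (\<epsilon> C \<cdot> q) = \<e> A \<otimes> \<epsilon> B"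
      using Cmp_Cmp[of w "\<epsilon> C" p] Cmp_Cmp[of w "\<epsilon> C" q] by (simp_all add: w sp sq)
    then have pq: "(w \<otimes> w) \<cdot> ((\<epsilon> C \<cdot> p) \<otimes> (\<epsilon> C \<cdot> q)) = (\<epsilon> A \<otimes> \<e> B) \<otimes> (\<e> A \<otimes> \<epsilon> B)"
      by (simp add: interchange w del: Ten_strict_simps)
    have "w \<cdot> g = (w \<cdot> \<Delta> C) \<cdot> ((\<epsilon> C \<cdot> p) \<otimes> (\<epsilon> C \<cdot> q))"
      by (simp add: g_def w)
    also have "\<dots> = (\<Delta> A \<otimes> \<Delta> B) \<cdot> (\<one> (!\<^sub>o A) \<otimes> \<sigma> (!\<^sub>o A) (!\<^sub>o B) \<otimes> \<one> (!\<^sub>o B))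
        \<cdot> ((\<epsilon> A \<otimes> \<e> B) \<otimes> (\<e> A \<otimes> \<epsilon> B))"
      unfolding wC by (simp add: pq[symmetric] w)
    finally show ?thesis by (simp only: swap_counits[OF assms(1,2)])
  qed
  \<comment> \<open>Both sides are coextensions: \<open>w\<close> followed by
    \<open>\<delta> C\<close> coextends \<open>w\<close>, so appending \<open>!\<^sub>a g\<close>
    coextends \<open>w \<cdot> g\<close>, which is
    \<open>\<epsilon> A \<otimes> \<epsilon> B\<close>.\<close>
  have m: "\<m>\<^sub>\<otimes> A B = w \<cdot> \<delta> C \<cdot> !\<^sub>a g"
  proof -
    have "w \<cdot> \<delta> C = coext A B w"
      using coext_Dig[of A B s] by (simp add: w)
    then show ?thesis
      by (simp add: coext_Bang Mon_eq_coext wg[symmetric] w)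
  qed
  \<comment> \<open>\<open>g\<close> is a tensor of two components after \<open>\<Delta> C\<close>,
    and its \<open>q\<close> component is zero on the image of \<open>i\<close>.\<close>
  have ig: "!\<^sub>a i \<cdot> g = \<zero> (!\<^sub>o A) (A \<odot> B)"
  proof -
    have "!\<^sub>a i \<cdot> g = (!\<^sub>a i \<cdot> \<Delta> C) \<cdot> ((\<epsilon> C \<cdot> p) \<otimes> (\<epsilon> C \<cdot> q))"
      by (simp add: g_def)
    also have "\<dots> = \<Delta> A \<cdot> ((!\<^sub>a i \<cdot> (\<epsilon> C \<cdot> p)) \<otimes> (!\<^sub>a i \<cdot> (\<epsilon> C \<cdot> q)))"
      by (simp add: Bang_nat interchange)
    also have "!\<^sub>a i \<cdot> (\<epsilon> C \<cdot> q) = (!\<^sub>a i \<cdot> \<epsilon> C) \<cdot> q"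
      by simp
    also have "\<dots> = \<zero> (!\<^sub>o A) B"
      by (subst Bang_nat) simp_all
    finally show ?thesis by simp
  qed
  have left: "!\<^sub>a i \<cdot> (\<delta> C \<cdot> !\<^sub>a g) = \<e> A \<cdot> \<u> (A \<odot> B)"
  proof -
    have "!\<^sub>a i \<cdot> (\<delta> C \<cdot> !\<^sub>a g) = (!\<^sub>a i \<cdot> \<delta> C) \<cdot> !\<^sub>a g"
      by simp
    also have "\<dots> = \<delta> A \<cdot> !\<^sub>a (!\<^sub>a i \<cdot> g)"
      by (subst Bang_nat) (simp_all add: Bang_Cmp')
    finally show ?thesis by (simp add: ig Dig_Bang_Zero)
  qed
  have right: "(\<one> (!\<^sub>o A) \<otimes> \<eta> B) \<cdot> (w \<cdot> g) = \<epsilon> A \<otimes> \<one> B"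
    by (simp add: wg interchange linear_rule)
  \<comment> \<open>The chain rule at \<open>C\<close>, followed by \<open>!\<^sub>a g\<close>.
    Naturality of \<open>\<nabla>\<close> sends \<open>!\<^sub>a g\<close> into both factors, and
    naturality of \<open>\<eta>\<close> turns it into \<open>g\<close> before \<open>\<eta>\<close>
    in the second.\<close>
  have chain: "(\<one> (!\<^sub>o C) \<otimes> \<eta> C) \<cdot> (\<nabla> C \<cdot> (\<delta> C \<cdot> !\<^sub>a g))
      = (\<Delta> C \<otimes> \<eta> C) \<cdot> (((\<delta> C \<cdot> !\<^sub>a g) \<otimes> (\<nabla> C \<cdot> (g \<cdot> \<eta> (A \<odot> B)))) \<cdot> \<nabla> (A \<odot> B))"
  proof -
    have "(\<one> (!\<^sub>o C) \<otimes> \<eta> C) \<cdot> (\<nabla> C \<cdot> (\<delta> C \<cdot> !\<^sub>a g))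
        = ((\<one> (!\<^sub>o C) \<otimes> \<eta> C) \<cdot> \<nabla> C \<cdot> \<delta> C) \<cdot> !\<^sub>a g"
      by simp
    also have "\<dots> = (\<Delta> C \<otimes> \<eta> C) \<cdot> ((\<one> (!\<^sub>o C) \<otimes> \<nabla> C) \<cdot> ((\<delta> C \<otimes> \<eta> (!\<^sub>o C)) \<cdot> (\<nabla> (!\<^sub>o C) \<cdot> !\<^sub>a g)))"
      by (subst chain_rule) simp_all
    also have "\<nabla> (!\<^sub>o C) \<cdot> !\<^sub>a g = (!\<^sub>a g \<otimes> !\<^sub>a g) \<cdot> \<nabla> (A \<odot> B)"
      by (subst induced_mult_nat) simp_all
    finally show ?thesis
      by (simp add: interchange_Cmp Coder_Bang)
  qed
  have "(\<one> (!\<^sub>o A) \<otimes> \<eta> B) \<cdot> \<m>\<^sub>\<otimes> A B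
      = ((\<one> (!\<^sub>o A) \<otimes> \<eta> B) \<cdot> (!\<^sub>a i \<otimes> !\<^sub>a j)) \<cdot> (\<nabla> C \<cdot> (\<delta> C \<cdot> !\<^sub>a g))"
    by (simp add: m w_def)
  \<comment> \<open>Naturality of \<open>\<eta>\<close> at \<open>j\<close> puts the injections in
    front and exposes the left-hand side of the chain rule at \<open>C\<close>.\<close>
  also have "(\<one> (!\<^sub>o A) \<otimes> \<eta> B) \<cdot> (!\<^sub>a i \<otimes> !\<^sub>a j) = (!\<^sub>a i \<otimes> j) \<cdot> (\<one> (!\<^sub>o C) \<otimes> \<eta> C)"
    by (simp add: interchange Coder_Bang)
  also have "((!\<^sub>a i \<otimes> j) \<cdot> (\<one> (!\<^sub>o C) \<otimes> \<eta> C)) \<cdot> (\<nabla> C \<cdot> (\<delta> C \<cdot> !\<^sub>a g))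
      = ((!\<^sub>a i \<otimes> j) \<cdot> (\<Delta> C \<otimes> \<eta> C))
        \<cdot> (((\<delta> C \<cdot> !\<^sub>a g) \<otimes> (\<nabla> C \<cdot> (g \<cdot> \<eta> (A \<odot> B)))) \<cdot> \<nabla> (A \<odot> B))"
    by (simp add: chain)
  also have "(!\<^sub>a i \<otimes> j) \<cdot> (\<Delta> C \<otimes> \<eta> C)
      = (\<Delta> A \<otimes> \<one> B) \<cdot> ((!\<^sub>a i \<otimes> !\<^sub>a i) \<otimes> (\<eta> B \<cdot> !\<^sub>a j))"
    by (simp add: interchange Bang_nat Coder_Bang del: Ten_strict_simps)
  \<comment> \<open>One copy of \<open>!\<^sub>a i\<close> stays alone and will be handled by
    \<open>left\<close>; the other is paired with \<open>!\<^sub>a j\<close>, so that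
    \<open>w\<close> reappears in the second factor.\<close>
  also have "(!\<^sub>a i \<otimes> !\<^sub>a i) \<otimes> (\<eta> B \<cdot> !\<^sub>a j)
      = !\<^sub>a i \<otimes> ((\<one> (!\<^sub>o A) \<otimes> \<eta> B) \<cdot> (!\<^sub>a i \<otimes> !\<^sub>a j))"
    by (simp add: interchange)
  also have "((\<Delta> A \<otimes> \<one> B) \<cdot> (!\<^sub>a i \<otimes> ((\<one> (!\<^sub>o A) \<otimes> \<eta> B) \<cdot> (!\<^sub>a i \<otimes> !\<^sub>a j))))
        \<cdot> (((\<delta> C \<cdot> !\<^sub>a g) \<otimes> (\<nabla> C \<cdot> (g \<cdot> \<eta> (A \<odot> B)))) \<cdot> \<nabla> (A \<odot> B))
      = (\<Delta> A \<otimes> \<one> B) \<cdot> (((!\<^sub>a i \<cdot> (\<delta> C \<cdot> !\<^sub>a g))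
          \<otimes> (((\<one> (!\<^sub>o A) \<otimes> \<eta> B) \<cdot> (w \<cdot> g)) \<cdot> \<eta> (A \<odot> B))) \<cdot> \<nabla> (A \<odot> B))"
    by (subst Cmp_Cmp) (simp_all add: interchange_Cmp w_def)
  also have "\<dots> = (\<Delta> A \<otimes> \<one> B)
      \<cdot> (((\<e> A \<otimes> (\<epsilon> A \<otimes> \<one> B)) \<cdot> (\<u> (A \<odot> B) \<otimes> \<eta> (A \<odot> B))) \<cdot> \<nabla> (A \<odot> B))"
    unfolding left right by (simp add: interchange del: Ten_strict_simps)
  also have "\<dots> = ((\<Delta> A \<otimes> \<one> B) \<cdot> ((\<e> A \<otimes> \<epsilon> A) \<otimes> \<one> B))
      \<cdot> ((\<u> (A \<odot> B) \<otimes> \<eta> (A \<odot> B)) \<cdot> \<nabla> (A \<odot> B))"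
    by simp
  \<comment> \<open>The first factor only discards its copy of the argument and contributes a unit.
    The counit law absorbs the discarding here, and the unit law of \<open>\<nabla>\<close> absorbs
    the unit next.\<close>
  also have "(\<Delta> A \<otimes> \<one> B) \<cdot> ((\<e> A \<otimes> \<epsilon> A) \<otimes> \<one> B) = \<epsilon> A \<otimes> \<one> B"
    by (simp add: interchange Comul_Der_Couni del: Ten_strict_simps)
  also have "(\<u> (A \<odot> B) \<otimes> \<eta> (A \<odot> B)) \<cdot> \<nabla> (A \<odot> B)
      = (\<one> \<K> \<otimes> \<eta> (A \<odot> B)) \<cdot> ((\<u> (A \<odot> B) \<otimes> \<one> (!\<^sub>o (A \<odot> B))) \<cdot> \<nabla> (A \<odot> B))"
    by (simp add: interchange_Cmp del: Ten_strict_simps)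
  also have "\<dots> = \<eta> (A \<odot> B)"
    by (subst induced_unit_mult) simp_all
  finally show ?thesis .
qed

text \<open>Orthogonality is checked factorwise by interchange: \<open>\<eta>\<close> followed by
  \<open>\<epsilon>\<close> and \<open>\<u>\<close> followed by \<open>\<e>\<close> give the
  identities, while \<open>\<eta>\<close> followed by \<open>\<e>\<close> and \<open>\<u>\<close>
  followed by \<open>\<epsilon>\<close> give the zeros. Strictness lets
  \<open>\<eta> A \<otimes> \<u> B\<close> start at \<open>A\<close>.\<close>

lemma monoidal_rule:
  assumes [simp]: "A \<in> Ob X" "B \<in> Ob X"
  shows "(\<one> (!\<^sub>o A) \<otimes> \<eta> B) \<cdot> \<m>\<^sub>\<otimes> A B = (\<epsilon> A \<otimes> \<one> B) \<cdot> \<eta> (A \<odot> B)"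
proof (rule monoidal_rule_of_weak_biproduct[where C = "!\<^sub>o A \<odot> !\<^sub>o B" and i = "\<eta> A \<otimes> \<u> B"
      and j = "\<u> A \<otimes> \<eta> B" and p = "\<epsilon> A \<otimes> \<e> B" and q = "\<e> A \<otimes> \<epsilon> B"])
qed (simp_all add: interchange linear_rule constant_rule)

end

theorem proposition6p4:
  fixes X :: "('o, 'a, 'm) mon_coalg_mod_scheme" (structure)
    and \<eta> :: "'o \<Rightarrow> 'a"
  assumes "additive_linear_category X"
    and "codereliction X (induced_mult X) (induced_unit X) \<eta>"
    and "A \<in> Ob X" and "B \<in> Ob X"
  shows "(\<one> (!\<^sub>o A) \<otimes> \<eta> B) \<cdot> \<m>\<^sub>\<otimes> A B = (\<epsilon> A \<otimes> \<one> B) \<cdot> \<eta> (A \<odot> B)"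
proof -
  interpret additive_linear_category_with_codereliction X \<eta>
    using assms(1,2) by (rule additive_linear_category_with_codereliction.intro)
  show ?thesis using assms(3,4) by (rule monoidal_rule)
qed

end
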